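(* Let $x$ be a real number with $0<x\le 1/e$. Define a sequence by $y_1=1$ and, for $n\ge 1$, $$l_n=-\{3y_n-2+\ln(x/y_n)\},\qquad m_n=-2y_n\{y_n+\ln(x/y_n)\},$$ $$a_n=\tfrac12\left(l_n+\sqrt{l_n^2+4m_n}\right),\qquad y_{n+1}=y_n+a_n .$$ Then one of the real solutions $y$ of $-ye^{-y}=-x$ (i.e. of $W(-x)=-y$) is evaluated to any required accuracy by $y_n+a_n$ with $n$ large enough; that is, the sequence $(y_n)$ is a well-defined sequence of positive real numbers and $y_n+a_n$ converges, as $n\to\infty$, to a real solution $y$ of $ye^{-y}=x$.
   Context: $W$ denotes the real (two-branched) Lambert W relation: $W(-x)=-y$ means $-ye^{-y}=-x$. For $0<x<1/e$ the equation $ye^{-y}=x$ has exactly two real solutions, one in $(0,1)$ and one in $(1,\infty)$; for $x=1/e$ they coincide (both equal $1$). The integer $n$ is the number of times the correction is applied. *)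

theory Defs
  imports Complex_Main
begin

text \<open>The two-branched real Lambert W, as a relation: \<open>lambert_W z w\<close> reads \<open>W(z) = w\<close>.\<close>

definition lambert_W :: "real \<Rightarrow> real \<Rightarrow> bool" where
  "lambert_W z w \<longleftrightarrow> w * exp w = z"

definition coeff_l :: "real \<Rightarrow> real \<Rightarrow> real" where
  "coeff_l x y = - (3 * y - 2 + ln (x / y))"

definition coeff_m :: "real \<Rightarrow> real \<Rightarrow> real" where
  "coeff_m x y = - 2 * y * (y + ln (x / y))"

definition discr :: "real \<Rightarrow> real \<Rightarrow> real" where
  "discr x y = (coeff_l x y)\<^sup>2 + 4 * coeff_m x y"

definition correction :: "real \<Rightarrow> real \<Rightarrow> real" where
  "correction x y = 1 / 2 * (coeff_l x y + sqrt (discr x y))"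

text \<open>The sequence is indexed from 1; the value at 0 is a dummy. Since \<open>ln\<close>, \<open>sqrt\<close> and
  division are total, the recursion always yields a real number; it is the intended sequence as
  long as \<open>y > 0\<close> and \<open>discr x y \<ge> 0\<close> at every \<open>y = lambert_iter x n\<close> with \<open>n \<ge> 1\<close>.\<close>

fun lambert_iter :: "real \<Rightarrow> nat \<Rightarrow> real" where
  "lambert_iter x 0 = 1"
| "lambert_iter x (Suc 0) = 1"
| "lambert_iter x (Suc (Suc n)) =
     lambert_iter x (Suc n) + correction x (lambert_iter x (Suc n))"

end

theory Submission imports Defs begin

text \<open>
  Put \<open>p(y) = y + ln (x / y)\<close>. For \<open>y > 0\<close> the equation \<open>y e\<^sup>-\<^sup>y = x\<close> says \<open>p(y) = 0\<close>, and adding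
  \<open>a\<close> to \<open>y\<close> changes \<open>p\<close> by \<open>a - ln (1 + a / y)\<close>. The correction \<open>a\<close> solves
  \<open>a\<^sup>2 = l a + m\<close>, which rearranges to \<open>p(y) = 2 a / (2 y + a) - a\<close>: it is the step that would hit the
  root exactly if \<open>ln (1 + u)\<close> were equal to its Pade approximant \<open>2 u / (2 + u)\<close> at \<open>u = a / y\<close>.

  For \<open>u \<ge> 0\<close> this approximant lies below the logarithm, so \<open>p(y + a) \<le> 0\<close>: the step never
  passes the root. At the starting point, \<open>p(1) = 1 + ln x \<le> 0\<close> because \<open>x \<le> 1 / e\<close>. The
  conditions \<open>y \<ge> 1\<close> and \<open>p(y) \<le> 0\<close> are therefore preserved, and under them the discriminant and
  the correction are nonnegative (lemma \<open>correction_step\<close>). The iterates increase, and they are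
  bounded because \<open>p\<close> tends to infinity; hence they converge, the corrections
  tend to \<open>0\<close>, and passing to the limit in \<open>p(y) = 2 a / (2 y + a) - a\<close> shows that \<open>p\<close> vanishes at
  the limit. This is the solution in \<open>[1, \<infinity>)\<close>.
\<close>

definition residual :: "real \<Rightarrow> real \<Rightarrow> real" where
  "residual x y = y + ln (x / y)"

lemma residual_zero_imp_lambert_W:
  assumes "0 < x" "0 < y" "residual x y = 0"
  shows "lambert_W (- x) (- y)"
proof -
  have "ln (x / y) = - y"
    using assms by (simp add: residual_def)
  then have "x / y = exp (- y)"
    using assms exp_ln[of "x / y"] by simp
  then show ?thesis
    using assms by (simp add: lambert_W_def field_simps)
qed

lemma residual_add:
  assumes "0 < x" "0 < y" "0 \<le> a"
  shows "residual x (y + a) = residual x y + a - ln (1 + a / y)"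
proof -
  have "1 + a / y = (y + a) / y"
    using assms by (simp add: field_simps)
  then show ?thesis
    using assms by (simp add: residual_def ln_div)
qed

text \<open>The logarithm in the residual grows at most like \<open>y / 2\<close>, so a nonpositive residual bounds
  \<open>y\<close>.\<close>

lemma residual_nonpos_imp_bounded:
  assumes "0 < x" "0 < y" "residual x y \<le> 0"
  shows "y \<le> - 2 * ln x"
proof -
  have "ln (y / 2) \<le> y / 2 - 1"
    using assms by (intro ln_le_minus_one) simp
  moreover have "ln 2 \<le> (1::real)"
    using ln_le_minus_one[of "2::real"] by simp
  ultimately have "ln y \<le> y / 2"
    using assms by (simp add: ln_div)
  then show ?thesis
    using assms by (simp add: residual_def ln_div)
qed

text \<open>The two sides agree at \<open>0\<close>, and the derivative of their difference is
  \<open>u\<^sup>2 / ((1 + u) (2 + u)\<^sup>2)\<close>.\<close>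

lemma pade_le_ln_one_plus:
  fixes u :: real
  assumes "0 \<le> u"
  shows "2 * u / (2 + u) \<le> ln (1 + u)"
proof -
  define f where "f = (\<lambda>v::real. ln (1 + v) - 2 * v / (2 + v))"
  have "f 0 \<le> f u"
  proof (rule DERIV_nonneg_imp_nondecreasing[OF assms])
    fix v :: real assume v: "0 \<le> v" "v \<le> u"
    have "(f has_real_derivative 1 / (1 + v) - (2 * (2 + v) - 2 * v) / ((2 + v) * (2 + v))) (at v)"
      unfolding f_def using v by (auto intro!: derivative_eq_intros)
    moreover have "1 / (1 + v) - (2 * (2 + v) - 2 * v) / ((2 + v) * (2 + v))
        = v\<^sup>2 / ((1 + v) * (2 + v)\<^sup>2)"
      using v by (simp add: divide_simps power2_eq_square) (simp add: algebra_simps)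
    ultimately show "\<exists>d. (f has_real_derivative d) (at v) \<and> 0 \<le> d"
      using v by (metis add_nonneg_nonneg divide_nonneg_nonneg mult_nonneg_nonneg
          zero_le_numeral zero_le_one zero_le_power2)
  qed
  then show ?thesis by (simp add: f_def)
qed

lemma correction_quadratic:
  assumes "0 \<le> discr x y"
  shows "(correction x y)\<^sup>2 = coeff_l x y * correction x y + coeff_m x y"
proof -
  define s where "s = sqrt (discr x y)"
  have "s\<^sup>2 = (coeff_l x y)\<^sup>2 + 4 * coeff_m x y"
    using assms by (simp add: s_def discr_def)
  then show ?thesis
    unfolding correction_def s_def[symmetric] by (simp add: power2_eq_square algebra_simps)
qed

text \<open>When \<open>y \<ge> 1\<close> has a nonpositive residual, \<open>m \<ge> 0\<close>, so the quadratic for the correction has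
  roots of opposite sign (or zero) and the correction is the nonnegative one. The last two
  conclusions are the defining equation of the step and the fact that the step stays on the
  same side of the root.\<close>

lemma correction_step:
  assumes "0 < x" "1 \<le> y" "residual x y \<le> 0"
  shows "0 \<le> discr x y"
    and "0 \<le> correction x y"
    and "residual x y = 2 * correction x y / (2 * y + correction x y) - correction x y"
    and "residual x (y + correction x y) \<le> 0"
proof -
  define a where "a = correction x y"
  define p where "p = residual x y"
  have m: "coeff_m x y = - 2 * y * p" and l: "coeff_l x y = - (2 * y - 2 + p)"
    by (simp_all add: coeff_m_def coeff_l_def p_def residual_def)
  have "0 \<le> coeff_m x y"
    using assms by (simp add: m p_def mult_nonneg_nonpos)
  then have disc: "(coeff_l x y)\<^sup>2 \<le> discr x y"
    by (simp add: discr_def)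
  show d: "0 \<le> discr x y"
    using disc zero_le_power2 order_trans by blast
  have "\<bar>coeff_l x y\<bar> \<le> sqrt (discr x y)"
    using disc by (simp add: real_le_rsqrt)
  then show a: "0 \<le> correction x y"
    by (simp add: correction_def)
  have "a\<^sup>2 = coeff_l x y * a + coeff_m x y"
    using correction_quadratic[OF d] by (simp add: a_def)
  then have "p * (2 * y + a) = 2 * a - a * (2 * y + a)"
    by (simp add: l m power2_eq_square algebra_simps)
  moreover have pos: "0 < 2 * y + a"
    using a assms by (simp add: a_def)
  ultimately have p: "p = 2 * a / (2 * y + a) - a"
    by (simp add: field_simps)
  then show "residual x y = 2 * correction x y / (2 * y + correction x y) - correction x y"
    by (simp add: a_def p_def)
  have "2 * a / (2 * y + a) = 2 * (a / y) / (2 + a / y)"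
    using assms pos by (simp add: field_simps)
  also have "\<dots> \<le> ln (1 + a / y)"
    using a assms by (intro pade_le_ln_one_plus) (simp add: a_def)
  finally have "p + a - ln (1 + a / y) \<le> 0"
    using p by simp
  then show "residual x (y + correction x y) \<le> 0"
    using residual_add[of x y a] a assms by (simp add: a_def p_def)
qed

lemma lambert_iter_invariant:
  assumes "0 < x" "x \<le> 1 / exp 1"
  shows "1 \<le> lambert_iter x (Suc n) \<and> residual x (lambert_iter x (Suc n)) \<le> 0"
proof (induction n)
  case 0
  have "ln x \<le> ln (1 / exp 1)"
    using assms by simp
  then show ?case
    by (simp add: residual_def ln_div)
next
  case (Suc n)
  then show ?case
    using correction_step(2,4)[OF assms(1)] by fastforce
qed

theorem lemma4:
  fixes x :: real
  assumes "0 < x" and "x \<le> 1 / exp 1"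
  shows "(\<forall>n\<ge>1. lambert_iter x n > 0 \<and> discr x (lambert_iter x n) \<ge> 0) \<and>
    (\<exists>y::real. lambert_W (- x) (- y) \<and>
      (\<lambda>n. lambert_iter x n + correction x (lambert_iter x n)) \<longlonglongrightarrow> y)"
proof
  define z where "z = (\<lambda>n. lambert_iter x (Suc n))"
  define a where "a = (\<lambda>n. correction x (z n))"
  have z_Suc: "z (Suc n) = z n + a n" for n
    by (simp add: z_def a_def)
  have z_ge1: "1 \<le> z n" and res: "residual x (z n) \<le> 0" for n
    using lambert_iter_invariant[OF assms] by (simp_all add: z_def)
  note step = correction_step[OF assms(1) z_ge1 res]
  show "\<forall>n\<ge>1. lambert_iter x n > 0 \<and> discr x (lambert_iter x n) \<ge> 0"
  proof (intro allI impI)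
    fix n :: nat assume "1 \<le> n"
    then obtain k where "n = Suc k" by (cases n) auto
    then show "lambert_iter x n > 0 \<and> discr x (lambert_iter x n) \<ge> 0"
      using z_ge1[of k] step(1)[of k] by (simp add: z_def)
  qed
  have "incseq z"
    using step(2) by (intro incseq_SucI) (simp add: z_Suc a_def)
  moreover have "z n \<le> - 2 * ln x" for n
    using residual_nonpos_imp_bounded[OF assms(1) _ res[of n]] z_ge1[of n] by simp
  ultimately obtain y where lim: "z \<longlonglongrightarrow> y"
    using incseq_convergent by metis
  have y: "1 \<le> y"
    using lim z_ge1 by (intro LIMSEQ_le_const) auto
  have lim_Suc: "(\<lambda>n. z (Suc n)) \<longlonglongrightarrow> y"
    using lim by (rule LIMSEQ_Suc)
  then have a0: "a \<longlonglongrightarrow> 0"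
    using tendsto_diff[OF lim_Suc lim] by (simp add: z_Suc)
  have "(\<lambda>n. 2 * a n / (2 * z n + a n) - a n) \<longlonglongrightarrow> 2 * 0 / (2 * y + 0) - 0"
    using y by (intro tendsto_intros lim a0) simp
  then have "(\<lambda>n. residual x (z n)) \<longlonglongrightarrow> 0"
    using step(3) by (simp add: a_def)
  moreover have "(\<lambda>n. residual x (z n)) \<longlonglongrightarrow> residual x y"
    unfolding residual_def using y assms by (intro tendsto_intros lim) auto
  ultimately have "residual x y = 0"
    by (rule LIMSEQ_unique[symmetric])
  then have "lambert_W (- x) (- y)"
    using y assms by (intro residual_zero_imp_lambert_W) auto
  moreover have "(\<lambda>n. lambert_iter x n + correction x (lambert_iter x n)) \<longlonglongrightarrow> y"
    by (rule LIMSEQ_imp_Suc) (use lim_Suc in \<open>simp add: z_def\<close>)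
  ultimately show "\<exists>y::real. lambert_W (- x) (- y) \<and>
      (\<lambda>n. lambert_iter x n + correction x (lambert_iter x n)) \<longlonglongrightarrow> y"
    by blast
qed

end
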